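(* Let $A,Q\in\mathbb{R}^{n\times n}$ with $Q$ symmetric positive definite, let $\alpha,\beta>0$, and let $(X_k,Y_k,Z_k,\Lambda_k,\Pi_k)_{k\ge0}$ be a sequence in $(\mathbb{R}^{n\times n})^5$ generated, from an arbitrary starting point, by the ADMM iteration $$\begin{cases} X_{k+1}=[\alpha AA^T+\beta I_n]^{-1}[A\Lambda_k+\Pi_k+\alpha AY_k+\beta Z_k],\\ Y_{k+1}=(1+\alpha)^{-1}[\alpha A^TX_{k+1}-Z_kA-Q-\Lambda_k],\\ Z_{k+1}=[(-Y_{k+1}-Q)A^T-\Pi_k+\beta X_{k+1}][AA^T+\beta I_n]^{-1},\\ \Lambda_{k+1}=\Lambda_k-\alpha(A^TX_{k+1}-Y_{k+1}),\\ \Pi_{k+1}=\Pi_k-\beta(X_{k+1}-Z_{k+1}). \end{cases}$$ Suppose that the multiplier sequence $(\Lambda_k,\Pi_k)$ is bounded and satisfies $$\sum_{k=0}^\infty\left(\|\Lambda_{k+1}-\Lambda_k\|_F^2+\|\Pi_{k+1}-\Pi_k\|_F^2\right)<\infty .$$ Then any accumulation point $(X^*,Y^*,Z^*,\Lambda^*,\Pi^* )$ of $(X_k,Y_k,Z_k,\Lambda_k,\Pi_k)$ satisfies the KKT optimality conditions $$\begin{cases} A\Lambda^*+\Pi^*=0,\\ Y^*+Z^*A+Q+\Lambda^*=0,\\ Z^*AA^T+(Y^*+Q)A^T+\Pi^*=0,\\ A^TX^*-Y^*=0,\\ X^*-Z^*=0 \end{cases}$$ of the problem $\min_{(X,Y,Z)}\frac12\|Y+ZA+Q\|_F^2$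 subject to $A^TX=Y$, $X=Z$.
   Context: $\|\cdot\|_F$ is the Frobenius norm and $\langle P,R\rangle=\mathrm{tr}(P^TR)$. The problem is a reformulation of the Lyapunov equation $A^TX+XA+Q=0$. Its augmented Lagrangian is $$\mathcal{L}_{\mathcal A}(X,Y,Z,\Lambda,\Pi)=\tfrac12\|Y+ZA+Q\|_F^2-\langle\Lambda,A^TX-Y\rangle-\langle\Pi,X-Z\rangle+\tfrac{\alpha}{2}\|A^TX-Y\|_F^2+\tfrac{\beta}{2}\|X-Z\|_F^2,$$ and the first three updates in the ADMM iteration are the successive exact minimizations of $\mathcal{L}_{\mathcal A}$ over $X$, then $Y$, then $Z$, the other variables being held at their most recent values. *)

theory Defs
  imports "HOL-Analysis.Analysis"
begin

definition sym_pos_def :: "real ^ 'n ^ 'n \<Rightarrow> bool" where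
  "sym_pos_def Q \<longleftrightarrow> transpose Q = Q \<and> (\<forall>x. x \<noteq> 0 \<longrightarrow> x \<bullet> (Q *v x) > 0)"

text \<open>Accumulation point of a sequence, i.e. limit of a subsequence. This differs from
  \<^const>\<open>islimpt\<close> applied to the range: a constant sequence accumulates at its value.\<close>

definition accumulation_point :: "(nat \<Rightarrow> 'a::topological_space) \<Rightarrow> 'a \<Rightarrow> bool" where
  "accumulation_point s l \<longleftrightarrow> (\<exists>r. strict_mono r \<and> (s \<circ> r) \<longlonglongrightarrow> l)"

text \<open>On \<^typ>\<open>real ^ 'n ^ 'n\<close> the library's \<^const>\<open>inner\<close> and \<^const>\<open>norm\<close> are the trace inner
  product and the Frobenius norm.\<close>

lemma inner_matrix_eq_trace:
  fixes P R :: "real ^ 'n ^ 'n"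
  shows "P \<bullet> R = trace (transpose P ** R)"
  unfolding inner_vec_def trace_def transpose_def matrix_matrix_mult_def
  by (simp, rule sum.swap)

lemma norm_matrix_eq_frobenius:
  fixes P :: "real ^ 'n ^ 'n"
  shows "norm P = sqrt (\<Sum>i\<in>UNIV. \<Sum>j\<in>UNIV. (P $ i $ j)\<^sup>2)"
  by (simp add: norm_eq_sqrt_inner inner_vec_def power2_eq_square)

definition lyapunov_objective ::
  "real ^ 'n ^ 'n \<Rightarrow> real ^ 'n ^ 'n \<Rightarrow> real ^ 'n ^ 'n \<Rightarrow> real ^ 'n ^ 'n \<Rightarrow> real" where
  "lyapunov_objective A Q Y Z = (1/2) * (norm (Y + Z ** A + Q))\<^sup>2"

definition lyapunov_lagrangian ::
  "real ^ 'n ^ 'n \<Rightarrow> real ^ 'n ^ 'n \<Rightarrow> real ^ 'n ^ 'n \<Rightarrow> real ^ 'n ^ 'n \<Rightarrow> real ^ 'n ^ 'n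
    \<Rightarrow> real ^ 'n ^ 'n \<Rightarrow> real ^ 'n ^ 'n \<Rightarrow> real" where
  "lyapunov_lagrangian A Q X Y Z L P =
     lyapunov_objective A Q Y Z - L \<bullet> (transpose A ** X - Y) - P \<bullet> (X - Z)"

definition kkt_conditions ::
  "real ^ 'n ^ 'n \<Rightarrow> real ^ 'n ^ 'n \<Rightarrow> real ^ 'n ^ 'n \<Rightarrow> real ^ 'n ^ 'n \<Rightarrow> real ^ 'n ^ 'n
    \<Rightarrow> real ^ 'n ^ 'n \<Rightarrow> real ^ 'n ^ 'n \<Rightarrow> bool" where
  "kkt_conditions A Q X Y Z L P \<longleftrightarrow>
     A ** L + P = 0 \<and>
     Y + Z ** A + Q + L = 0 \<and>
     Z ** A ** transpose A + (Y + Q) ** transpose A + P = 0 \<and>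
     transpose A ** X - Y = 0 \<and>
     X - Z = 0"

text \<open>The system \<^const>\<open>kkt_conditions\<close> says exactly that the Lagrangian of the problem of minimizing
  \<^const>\<open>lyapunov_objective\<close> subject to \<open>transpose A ** X = Y\<close> and \<open>X = Z\<close> is stationary
  in \<open>(X, Y, Z)\<close> and that \<open>(X, Y, Z)\<close> is feasible; \<open>L\<close> and \<open>P\<close> are the multipliers of the
  first and second constraint.\<close>

lemma inner_mult_left_matrix:
  fixes A B C :: "real ^ 'n ^ 'n"
  shows "B \<bullet> (transpose A ** C) = (A ** B) \<bullet> C"
  by (simp add: inner_matrix_eq_trace matrix_transpose_mul matrix_mul_assoc)

lemma inner_mult_right_matrix:
  fixes A B C :: "real ^ 'n ^ 'n"
  shows "B \<bullet> (C ** A) = (B ** transpose A) \<bullet> C"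
proof -
  have "B \<bullet> (C ** A) = trace ((transpose B ** C) ** A)"
    by (simp add: inner_matrix_eq_trace matrix_mul_assoc)
  also have "\<dots> = trace (A ** (transpose B ** C))"
    by (rule trace_mul_sym)
  also have "\<dots> = (B ** transpose A) \<bullet> C"
    by (simp add: inner_matrix_eq_trace matrix_transpose_mul matrix_mul_assoc)
  finally show ?thesis .
qed

lemma bounded_linear_matrix_mult:
  fixes A :: "real ^ 'n ^ 'n"
  shows "bounded_linear (\<lambda>M. A ** M)" and "bounded_linear (\<lambda>M. M ** A)"
  by (auto intro!: linear_conv_bounded_linear[THEN iffD1] linearI
      simp: matrix_matrix_mult_def vec_eq_iff sum.distrib distrib_left distrib_right sum_distrib_left ac_simps)

lemma kkt_conditions_iff_stationary_feasible:
  fixes A Q X Y Z L P :: "real ^ 'n ^ 'n"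
  shows "kkt_conditions A Q X Y Z L P \<longleftrightarrow>
    ((\<lambda>(X, Y, Z). lyapunov_lagrangian A Q X Y Z L P) has_derivative (\<lambda>_. 0)) (at (X, Y, Z)) \<and>
    transpose A ** X = Y \<and> X = Z"
proof -
  define W where "W = Y + Z ** A + Q"
  define D where "D = (\<lambda>(U, V, S). (- (A ** L + P)) \<bullet> U + (W + L) \<bullet> V + (W ** transpose A + P) \<bullet> S)"
  note lin = bounded_linear.has_derivative[OF bounded_linear_matrix_mult(1)]
    bounded_linear.has_derivative[OF bounded_linear_matrix_mult(2)]
  have "((\<lambda>p. (1/2) * ((fst (snd p) + snd (snd p) ** A + Q) \<bullet> (fst (snd p) + snd (snd p) ** A + Q))
        - L \<bullet> (transpose A ** fst p - fst (snd p)) - P \<bullet> (fst p - snd (snd p)))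
      has_derivative (\<lambda>p. (1/2) * (W \<bullet> (fst (snd p) + snd (snd p) ** A)
          + (fst (snd p) + snd (snd p) ** A) \<bullet> W)
        - L \<bullet> (transpose A ** fst p - fst (snd p)) - P \<bullet> (fst p - snd (snd p)))) (at (X, Y, Z))"
    by (auto intro!: derivative_eq_intros lin simp: W_def)
  moreover have "(1/2) * (W \<bullet> (V + S ** A) + (V + S ** A) \<bullet> W)
      - L \<bullet> (transpose A ** U - V) - P \<bullet> (U - S) = D (U, V, S)" for U V S
    unfolding inner_commute[of "V + S ** A" W] D_def prod.case
    by (simp add: inner_add_left inner_add_right inner_diff_left inner_diff_right
        inner_mult_left_matrix inner_mult_right_matrix[where A = A and C = S])
  then have "(\<lambda>p. (1/2) * (W \<bullet> (fst (snd p) + snd (snd p) ** A)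
          + (fst (snd p) + snd (snd p) ** A) \<bullet> W)
        - L \<bullet> (transpose A ** fst p - fst (snd p)) - P \<bullet> (fst p - snd (snd p))) = D"
    by (metis (no_types, lifting) ext prod.collapse)
  ultimately have der:
    "((\<lambda>(X, Y, Z). lyapunov_lagrangian A Q X Y Z L P) has_derivative D) (at (X, Y, Z))"
    by (simp only: lyapunov_lagrangian_def lyapunov_objective_def power2_norm_eq_inner case_prod_beta')
  have "((\<lambda>(X, Y, Z). lyapunov_lagrangian A Q X Y Z L P) has_derivative (\<lambda>_. 0)) (at (X, Y, Z))
      \<longleftrightarrow> D = (\<lambda>_. 0)"
    using der has_derivative_unique by metis
  also have "\<dots> \<longleftrightarrow> A ** L + P = 0 \<and> W + L = 0 \<and> W ** transpose A + P = 0"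
  proof
    assume "D = (\<lambda>_. 0)"
    then have *: "D (U, V, S) = 0" for U V S
      by simp
    have "(A ** L + P) \<bullet> (A ** L + P) = 0"
      using *[of "A ** L + P" 0 0] unfolding D_def prod.case inner_zero_right inner_minus_left by simp
    moreover have "(W + L) \<bullet> (W + L) = 0"
      using *[of 0 "W + L" 0] unfolding D_def prod.case inner_zero_right by simp
    moreover have "(W ** transpose A + P) \<bullet> (W ** transpose A + P) = 0"
      using *[of 0 0 "W ** transpose A + P"] unfolding D_def prod.case inner_zero_right by simp
    ultimately show "A ** L + P = 0 \<and> W + L = 0 \<and> W ** transpose A + P = 0"
      by (simp only: inner_eq_zero_iff)
  next
    assume h: "A ** L + P = 0 \<and> W + L = 0 \<and> W ** transpose A + P = 0"
    show "D = (\<lambda>_. 0)"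
      unfolding D_def h[THEN conjunct1] h[THEN conjunct2, THEN conjunct1] h[THEN conjunct2, THEN conjunct2]
      by (simp add: fun_eq_iff)
  qed
  finally have stat: "((\<lambda>(X, Y, Z). lyapunov_lagrangian A Q X Y Z L P) has_derivative (\<lambda>_. 0)) (at (X, Y, Z))
      \<longleftrightarrow> A ** L + P = 0 \<and> W + L = 0 \<and> W ** transpose A + P = 0" .
  have "W = Z ** A + (Y + Q)"
    by (simp add: W_def)
  then have "W ** transpose A = Z ** A ** transpose A + (Y + Q) ** transpose A"
    by (simp only: linear_add[OF bounded_linear.linear[OF bounded_linear_matrix_mult(2)]])
  then show ?thesis
    unfolding kkt_conditions_def stat by (auto simp: W_def)
qed

end

theory Submission
  imports Defs
begin

text \<open>The augmented Lagrangian serves as a Lyapunov function. Each exact minimization over one block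
  lowers it, in the \<open>Y\<close> and \<open>Z\<close> blocks by a positive multiple of the squared step
  because of strong convexity, and the multiplier update raises it by
  \<open>\<parallel>\<Delta>\<Lambda>\<parallel>\<^sup>2 / \<alpha> + \<parallel>\<Delta>\<Pi>\<parallel>\<^sup>2 / \<beta>\<close>, which is summable by assumption.
  Completing squares shows that it stays bounded below along bounded multipliers, so the
  steps in \<open>Y\<close> and \<open>Z\<close> are square summable and tend to 0. The optimality conditions of the
  three minimizations are the KKT equations up to terms linear in these steps, and hence hold
  in the limit along a subsequence.\<close>

section \<open>Preliminaries: linearity of matrix products, summability, invertibility\<close>

lemmas matrix_mult_left_linear = bounded_linear.linear[OF bounded_linear_matrix_mult(1)]
lemmas matrix_mult_right_linear = bounded_linear.linear[OF bounded_linear_matrix_mult(2)]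

lemmas matrix_mult_linear_simps =
  linear_add[OF matrix_mult_left_linear] linear_add[OF matrix_mult_right_linear]
  linear_diff[OF matrix_mult_left_linear] linear_diff[OF matrix_mult_right_linear]
  linear_neg[OF matrix_mult_left_linear] linear_neg[OF matrix_mult_right_linear]
  linear_scale[OF matrix_mult_left_linear] linear_scale[OF matrix_mult_right_linear]

text \<open>Telescoping bounds each partial sum of \<open>d\<close> by \<open>V 0 - V n\<close> plus
  a partial sum of \<open>e\<close>, hence by a constant independent of \<open>n\<close>.\<close>

lemma summable_of_perturbed_descent:
  fixes V d e :: "nat \<Rightarrow> real"
  assumes step: "\<And>k. V (Suc k) + d k \<le> V k + e k"
    and "summable e" and e: "\<And>k. 0 \<le> e k" and d: "\<And>k. 0 \<le> d k" and V: "\<And>k. C \<le> V k"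
  shows "summable d"
proof (rule summableI_nonneg_bounded[OF d])
  fix n
  have "V n + (\<Sum>i<n. d i) \<le> V 0 + (\<Sum>i<n. e i)"
  proof (induction n)
    case (Suc n)
    then show ?case using step[of n] by simp
  qed simp
  moreover have "(\<Sum>i<n. e i) \<le> suminf e"
    using assms(2) e by (intro sum_le_suminf) auto
  ultimately show "(\<Sum>i<n. d i) \<le> V 0 + suminf e - C"
    using V[of n] by linarith
qed

lemma tendsto_zero_of_summable_norm_sq:
  fixes f :: "nat \<Rightarrow> 'a::real_normed_vector"
  assumes "summable (\<lambda>k. (norm (f k))\<^sup>2)"
  shows "f \<longlonglongrightarrow> 0"
proof -
  have "(\<lambda>k. sqrt ((norm (f k))\<^sup>2)) \<longlonglongrightarrow> sqrt 0"
    by (intro tendsto_real_sqrt summable_LIMSEQ_zero assms)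
  then show ?thesis
    by (simp add: tendsto_norm_zero_iff)
qed

text \<open>The quadratic form of this matrix at \<open>v\<close> is \<open>c\<close> times the
  squared norm of \<open>transpose A *v v\<close> plus \<beta> times that of \<open>v\<close>, so
  the kernel is trivial. The X update takes \<open>c\<close> = \<alpha>, the Z update
  \<open>c\<close> = 1.\<close>

lemma invertible_gram_plus_scaled_identity:
  fixes A :: "real ^ 'n ^ 'n"
  assumes "c \<ge> 0" "\<beta> > 0"
  shows "invertible (c *\<^sub>R (A ** transpose A) + \<beta> *\<^sub>R mat 1)"
  unfolding invertible_left_inverse matrix_left_invertible_ker
proof (intro allI impI)
  fix v :: "real ^ 'n"
  assume "(c *\<^sub>R (A ** transpose A) + \<beta> *\<^sub>R mat 1) *v v = 0"
  then have "v \<bullet> (c *\<^sub>R (A *v (transpose A *v v)) + \<beta> *\<^sub>R v) = 0"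
    unfolding matrix_vector_mult_add_rdistrib matrix_vector_mul_assoc
    by (simp flip: scaleR_matrix_vector_assoc)
  moreover have "v \<bullet> (A *v (transpose A *v v)) = (transpose A *v v) \<bullet> (transpose A *v v)"
    by (simp add: dot_lmul_matrix[symmetric])
  ultimately have "c * (norm (transpose A *v v))\<^sup>2 + \<beta> * (norm v)\<^sup>2 = 0"
    by (simp add: inner_add_right power2_norm_eq_inner)
  then have "\<beta> * (norm v)\<^sup>2 \<le> 0"
    using assms by (smt (verit) mult_nonneg_nonneg zero_le_power2)
  then show "v = 0"
    using assms by (simp add: mult_le_0_iff)
qed

lemma matrix_inv_mult_cancel:
  fixes M :: "real ^ 'n ^ 'n"
  assumes "invertible M"
  shows "M ** (matrix_inv M ** R) = R" and "(R ** matrix_inv M) ** M = R"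
proof -
  have "M ** matrix_inv M = mat 1 \<and> matrix_inv M ** M = mat 1"
    using assms unfolding invertible_def matrix_inv_def by (rule someI_ex)
  then show "M ** (matrix_inv M ** R) = R" "(R ** matrix_inv M) ** M = R"
    by (simp add: matrix_mul_assoc, simp flip: matrix_mul_assoc)
qed

section \<open>Effect of each update on the augmented Lagrangian, and its lower bound\<close>

definition augmented_lagrangian ::
  "real ^ 'n ^ 'n \<Rightarrow> real ^ 'n ^ 'n \<Rightarrow> real \<Rightarrow> real \<Rightarrow> real ^ 'n ^ 'n \<Rightarrow> real ^ 'n ^ 'n
    \<Rightarrow> real ^ 'n ^ 'n \<Rightarrow> real ^ 'n ^ 'n \<Rightarrow> real ^ 'n ^ 'n \<Rightarrow> real" where
  "augmented_lagrangian A Q \<alpha> \<beta> X Y Z L P =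
     lyapunov_lagrangian A Q X Y Z L P
     + \<alpha> / 2 * (norm (transpose A ** X - Y))\<^sup>2 + \<beta> / 2 * (norm (X - Z))\<^sup>2"

lemmas augmented_lagrangian_expand =
  augmented_lagrangian_def lyapunov_lagrangian_def lyapunov_objective_def

lemma norm_add_sq:
  fixes u v :: "'a::real_inner"
  shows "(norm (u + v))\<^sup>2 = (norm u)\<^sup>2 + 2 * (u \<bullet> v) + (norm v)\<^sup>2"
  by (simp add: power2_norm_eq_inner inner_add_left inner_add_right inner_commute)

text \<open>The function is quadratic in \<open>X\<close>, so its second-order expansion about
  \<open>X'\<close> is exact. Pairing \<open>opt\<close> with \<open>X - X'\<close> and moving
  \<open>A\<close> across the inner product cancels the linear terms; the pure squares
  remain.\<close>

lemma augmented_lagrangian_X_step: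
  fixes A Q X X' Y Z L P :: "real ^ 'n ^ 'n"
  assumes opt: "\<alpha> *\<^sub>R (A ** (transpose A ** X' - Y)) + \<beta> *\<^sub>R (X' - Z) = A ** L + P"
  shows "augmented_lagrangian A Q \<alpha> \<beta> X Y Z L P = augmented_lagrangian A Q \<alpha> \<beta> X' Y Z L P
    + \<alpha> / 2 * (norm (transpose A ** (X - X')))\<^sup>2 + \<beta> / 2 * (norm (X - X'))\<^sup>2"
proof -
  define T R D where "T = transpose A ** X' - Y" and "R = X' - Z" and "D = X - X'"
  have T: "transpose A ** X - Y = T + transpose A ** D" and R: "X - Z = R + D"
    by (simp_all add: T_def R_def D_def matrix_mult_linear_simps)
  have "(\<alpha> *\<^sub>R (A ** T) + \<beta> *\<^sub>R R) \<bullet> D = (A ** L + P) \<bullet> D"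
    using opt by (simp add: T_def R_def)
  then have "\<alpha> * (T \<bullet> (transpose A ** D)) + \<beta> * (R \<bullet> D) = L \<bullet> (transpose A ** D) + P \<bullet> D"
    by (simp add: inner_mult_left_matrix inner_add_left)
  then show ?thesis
    unfolding augmented_lagrangian_expand T R T_def[symmetric] R_def[symmetric] D_def[symmetric]
    unfolding norm_add_sq inner_add_right
    by (simp add: field_simps)
qed

text \<open>Exact expansion about the stationary point \<open>Y'\<close>; in the coefficient 1 +
  \<alpha>, the 1 comes from the objective and \<alpha> from the penalty.\<close>

lemma augmented_lagrangian_Y_step:
  fixes A Q X Y Y' Z L P :: "real ^ 'n ^ 'n"
  assumes opt: "Y' + Z ** A + Q + L = \<alpha> *\<^sub>R (transpose A ** X - Y')"
  shows "augmented_lagrangian A Q \<alpha> \<beta> X Y Z L P = augmented_lagrangian A Q \<alpha> \<beta> X Y' Z L P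
    + (1 + \<alpha>) / 2 * (norm (Y - Y'))\<^sup>2"
proof -
  define W T D where "W = Y' + Z ** A + Q" and "T = transpose A ** X - Y'" and "D = Y - Y'"
  \<comment> \<open>The form \<open>T + - D\<close> lets \<open>norm_add_sq\<close> and
    \<open>inner_add_right\<close> expand this residual as well.\<close>
  have W: "Y + Z ** A + Q = W + D" and T: "transpose A ** X - Y = T + - D"
    by (simp_all add: T_def W_def D_def)
  have "(W + L) \<bullet> D = \<alpha> * (T \<bullet> D)"
    using opt by (simp add: T_def W_def)
  then have "W \<bullet> D + L \<bullet> D = \<alpha> * (T \<bullet> D)"
    by (simp add: inner_add_left)
  then show ?thesis
    unfolding augmented_lagrangian_expand W T T_def[symmetric] W_def[symmetric] D_def[symmetric]
    unfolding norm_add_sq inner_add_right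
    by (simp add: field_simps)
qed

lemma augmented_lagrangian_Z_step:
  fixes A Q X Y Z Z' L P :: "real ^ 'n ^ 'n"
  assumes opt: "(Y + Z' ** A + Q) ** transpose A + P = \<beta> *\<^sub>R (X - Z')"
  shows "augmented_lagrangian A Q \<alpha> \<beta> X Y Z L P = augmented_lagrangian A Q \<alpha> \<beta> X Y Z' L P
    + 1 / 2 * (norm ((Z - Z') ** A))\<^sup>2 + \<beta> / 2 * (norm (Z - Z'))\<^sup>2"
proof -
  define W R D where "W = Y + Z' ** A + Q" and "R = X - Z'" and "D = Z - Z'"
  have W: "Y + Z ** A + Q = W + D ** A" and R: "X - Z = R + - D"
    by (simp_all add: W_def R_def D_def matrix_mult_linear_simps)
  have "(W ** transpose A + P) \<bullet> D = \<beta> * (R \<bullet> D)"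
    using opt by (simp add: R_def W_def)
  then have "W \<bullet> (D ** A) + P \<bullet> D = \<beta> * (R \<bullet> D)"
    by (simp add: inner_mult_right_matrix inner_add_left)
  then show ?thesis
    unfolding augmented_lagrangian_expand W R W_def[symmetric] R_def[symmetric] D_def[symmetric]
    unfolding norm_add_sq inner_add_right
    by (simp add: field_simps)
qed

text \<open>Multipliers enter linearly, paired with the constraint residuals, and the residuals are
  themselves the multiplier steps divided by -\<alpha> and -\<beta>.\<close>

lemma augmented_lagrangian_multiplier_step:
  fixes A Q X Y Z L L' P P' :: "real ^ 'n ^ 'n"
  assumes "\<alpha> > 0" "\<beta> > 0"
    and L: "L' = L - \<alpha> *\<^sub>R (transpose A ** X - Y)" and P: "P' = P - \<beta> *\<^sub>R (X - Z)"
  shows "augmented_lagrangian A Q \<alpha> \<beta> X Y Z L' P' = augmented_lagrangian A Q \<alpha> \<beta> X Y Z L P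
    + (norm (L' - L))\<^sup>2 / \<alpha> + (norm (P' - P))\<^sup>2 / \<beta>"
proof -
  have step: "M' \<bullet> T = M \<bullet> T - (norm (M' - M))\<^sup>2 / c"
    if "c > 0" "M' = M - c *\<^sub>R T" for c and M M' T :: "real ^ 'n ^ 'n"
    using that(1) unfolding that(2)
    by (simp add: inner_diff_left power_mult_distrib dot_square_norm power2_eq_square)
  show ?thesis
    unfolding augmented_lagrangian_expand step[OF assms(1) L] step[OF assms(2) P] by simp
qed

lemma augmented_lagrangian_lower_bound:
  fixes A Q X Y Z L P :: "real ^ 'n ^ 'n"
  assumes "\<alpha> > 0" "\<beta> > 0"
  shows "- (norm L)\<^sup>2 / (2 * \<alpha>) - (norm P)\<^sup>2 / (2 * \<beta>) \<le> augmented_lagrangian A Q \<alpha> \<beta> X Y Z L P"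
proof -
  have sq: "- (norm M)\<^sup>2 / (2 * c) \<le> c / 2 * (norm T)\<^sup>2 - M \<bullet> T"
    if "c > 0" for c and M T :: "real ^ 'n ^ 'n"
  proof -
    \<comment> \<open>Completed square: the minimum over \<open>T\<close> is attained at
      \<open>M\<close> divided by \<open>c\<close>.\<close>
    have "0 \<le> (norm (c *\<^sub>R T + - M))\<^sup>2 / (2 * c)"
      using that by simp
    also have "\<dots> = c / 2 * (norm T)\<^sup>2 - M \<bullet> T + (norm M)\<^sup>2 / (2 * c)"
      using that unfolding norm_add_sq
      by (simp add: power_mult_distrib inner_commute field_simps power2_eq_square)
    finally show ?thesis by simp
  qed
  show ?thesis
    using sq[OF assms(1), of L "transpose A ** X - Y"] sq[OF assms(2), of P "X - Z"]
      zero_le_power2[of "norm (Y + Z ** A + Q)"]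
    unfolding augmented_lagrangian_expand by linarith
qed

section \<open>Stationarity equations equivalent to the explicit update formulas\<close>

lemma X_update_optimality:
  fixes A L P X' Y Z :: "real ^ 'n ^ 'n"
  assumes "\<alpha> > 0" "\<beta> > 0"
    and X': "X' = matrix_inv (\<alpha> *\<^sub>R (A ** transpose A) + \<beta> *\<^sub>R mat 1) **
           (A ** L + P + \<alpha> *\<^sub>R (A ** Y) + \<beta> *\<^sub>R Z)"
  shows "\<alpha> *\<^sub>R (A ** (transpose A ** X' - Y)) + \<beta> *\<^sub>R (X' - Z) = A ** L + P"
proof -
  have "(\<alpha> *\<^sub>R (A ** transpose A) + \<beta> *\<^sub>R mat 1) ** X'
      = A ** L + P + \<alpha> *\<^sub>R (A ** Y) + \<beta> *\<^sub>R Z"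
    unfolding X' using assms(1,2)
    by (intro matrix_inv_mult_cancel invertible_gram_plus_scaled_identity) auto
  \<comment> \<open>With the inverse cleared, moving the \<open>Y\<close> and \<open>Z\<close> terms
    to the left produces the constraint residuals.\<close>
  then have "\<alpha> *\<^sub>R (A ** (transpose A ** X')) + \<beta> *\<^sub>R X'
      = A ** L + P + \<alpha> *\<^sub>R (A ** Y) + \<beta> *\<^sub>R Z"
    by (simp add: matrix_mult_linear_simps matrix_mul_assoc)
  then show ?thesis
    by (simp add: matrix_mult_linear_simps scaleR_diff_right algebra_simps)
qed

lemma Y_update_optimality:
  fixes A Q L X Y' Z :: "real ^ 'n ^ 'n"
  assumes "\<alpha> > 0"
    and Y': "Y' = inverse (1 + \<alpha>) *\<^sub>R (\<alpha> *\<^sub>R (transpose A ** X) - Z ** A - Q - L)"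
  shows "Y' + Z ** A + Q + L = \<alpha> *\<^sub>R (transpose A ** X - Y')"
proof -
  have "(1 + \<alpha>) *\<^sub>R Y' = \<alpha> *\<^sub>R (transpose A ** X) - Z ** A - Q - L"
    unfolding Y' using assms(1) by simp
  then show ?thesis
    by (simp add: scaleR_add_left scaleR_diff_right algebra_simps)
qed

lemma Z_update_optimality:
  fixes A Q P X Y Z' :: "real ^ 'n ^ 'n"
  assumes "\<beta> > 0"
    and Z': "Z' = ((- Y - Q) ** transpose A - P + \<beta> *\<^sub>R X) **
           matrix_inv (A ** transpose A + \<beta> *\<^sub>R mat 1)"
  shows "(Y + Z' ** A + Q) ** transpose A + P = \<beta> *\<^sub>R (X - Z')"
proof -
  have "Z' ** (A ** transpose A + \<beta> *\<^sub>R mat 1) = (- Y - Q) ** transpose A - P + \<beta> *\<^sub>R X"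
    unfolding Z' using assms(1) invertible_gram_plus_scaled_identity[of 1 \<beta> A]
    by (intro matrix_inv_mult_cancel) auto
  then have "Z' ** A ** transpose A + \<beta> *\<^sub>R Z' = (- Y - Q) ** transpose A - P + \<beta> *\<^sub>R X"
    by (simp add: matrix_mult_linear_simps matrix_mul_assoc)
  then show ?thesis
    by (simp add: matrix_mult_linear_simps scaleR_diff_right algebra_simps)
qed

section \<open>Descent along the iteration, vanishing steps, passage to the limit\<close>

theorem theorem6:
  fixes A Q :: "real ^ 'n ^ 'n"
    and \<alpha> \<beta> :: real
    and X Y Z L P :: "nat \<Rightarrow> real ^ 'n ^ 'n"
    and Xs Ys Zs Ls Ps :: "real ^ 'n ^ 'n"
  assumes "sym_pos_def Q"
    and "\<alpha> > 0" and "\<beta> > 0"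
    and "\<And>k. X (Suc k) = matrix_inv (\<alpha> *\<^sub>R (A ** transpose A) + \<beta> *\<^sub>R mat 1) **
           (A ** L k + P k + \<alpha> *\<^sub>R (A ** Y k) + \<beta> *\<^sub>R Z k)"
    and "\<And>k. Y (Suc k) = inverse (1 + \<alpha>) *\<^sub>R
           (\<alpha> *\<^sub>R (transpose A ** X (Suc k)) - Z k ** A - Q - L k)"
    and "\<And>k. Z (Suc k) =
           ((- Y (Suc k) - Q) ** transpose A - P k + \<beta> *\<^sub>R X (Suc k)) **
           matrix_inv (A ** transpose A + \<beta> *\<^sub>R mat 1)"
    and "\<And>k. L (Suc k) = L k - \<alpha> *\<^sub>R (transpose A ** X (Suc k) - Y (Suc k))"
    and "\<And>k. P (Suc k) = P k - \<beta> *\<^sub>R (X (Suc k) - Z (Suc k))"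
    and "bounded (range (\<lambda>k. (L k, P k)))"
    and "summable (\<lambda>k. (norm (L (Suc k) - L k))\<^sup>2 + (norm (P (Suc k) - P k))\<^sup>2)"
    and "accumulation_point (\<lambda>k. (X k, Y k, Z k, L k, P k)) (Xs, Ys, Zs, Ls, Ps)"
  shows "kkt_conditions A Q Xs Ys Zs Ls Ps"
proof -
  note optX = X_update_optimality[OF assms(2,3,4)]
  note optY = Y_update_optimality[OF assms(2,5)]
  note optZ = Z_update_optimality[OF assms(3,6)]
  note T = bounded_linear.tendsto[OF bounded_linear_matrix_mult(1)]
    bounded_linear.tendsto[OF bounded_linear_matrix_mult(2)]

  define V where "V k = augmented_lagrangian A Q \<alpha> \<beta> (X k) (Y k) (Z k) (L k) (P k)" for k
  \<comment> \<open>Only the part of the decrease that controls the Y and Z steps is recorded; the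
    other squares in the step identities are nonnegative.\<close>
  define d where "d k = (1 + \<alpha>) / 2 * (norm (Y (Suc k) - Y k))\<^sup>2
    + \<beta> / 2 * (norm (Z (Suc k) - Z k))\<^sup>2" for k
  define e where "e k = (norm (L (Suc k) - L k))\<^sup>2 / \<alpha> + (norm (P (Suc k) - P k))\<^sup>2 / \<beta>" for k

  have sumL: "summable (\<lambda>k. (norm (L (Suc k) - L k))\<^sup>2)"
    by (rule summable_comparison_test'[OF assms(10)]) auto
  have sumP: "summable (\<lambda>k. (norm (P (Suc k) - P k))\<^sup>2)"
    by (rule summable_comparison_test'[OF assms(10)]) auto

  obtain B where B: "norm (L k, P k) \<le> B" for k
    using assms(9) unfolding bounded_iff by auto
  have LB: "(norm (L k))\<^sup>2 \<le> B\<^sup>2" and PB: "(norm (P k))\<^sup>2 \<le> B\<^sup>2" for k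
    using B[of k] norm_fst_le[of "L k" "P k"] norm_snd_le[of "P k" "L k"]
    by (auto intro!: power_mono)
  have "- B\<^sup>2 / (2 * \<alpha>) - B\<^sup>2 / (2 * \<beta>) \<le> V k" for k
  proof -
    have "(norm (L k))\<^sup>2 / (2 * \<alpha>) \<le> B\<^sup>2 / (2 * \<alpha>)" "(norm (P k))\<^sup>2 / (2 * \<beta>) \<le> B\<^sup>2 / (2 * \<beta>)"
      using LB PB assms(2,3) by (auto intro!: divide_right_mono)
    then show ?thesis
      using augmented_lagrangian_lower_bound[OF assms(2,3), of "L k" "P k" A Q "X k" "Y k" "Z k"]
      unfolding V_def by simp
  qed
  moreover have "V (Suc k) + d k \<le> V k + e k" for k
  proof -
    \<comment> \<open>The four step identities chain from iterate \<open>k\<close> to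
      \<open>Suc k\<close> in update order; this bound and the one for the \<open>A\<close>-weighted
      Z step discard the extra squares.\<close>
    have "0 \<le> \<alpha> / 2 * (norm (transpose A ** (X k - X (Suc k))))\<^sup>2 + \<beta> / 2 * (norm (X k - X (Suc k)))\<^sup>2"
      using assms(2,3) by simp
    then show ?thesis
      using augmented_lagrangian_X_step[OF optX[of k], where Q = Q and X = "X k"]
        augmented_lagrangian_Y_step[OF optY[of k], where \<beta> = \<beta> and Y = "Y k" and P = "P k"]
        augmented_lagrangian_Z_step[OF optZ[of k], where \<alpha> = \<alpha> and Z = "Z k" and L = "L k"]
        augmented_lagrangian_multiplier_step[OF assms(2,3) assms(7,8)[of k], where Q = Q]
        zero_le_power2[of "norm ((Z k - Z (Suc k)) ** A)"]
      unfolding V_def d_def e_def norm_minus_commute[of "Y (Suc k)"] norm_minus_commute[of "Z (Suc k)"]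
      by linarith
  qed
  moreover have "summable e"
    unfolding e_def by (intro summable_add summable_divide sumL sumP)
  moreover have "0 \<le> e k" "0 \<le> d k" for k
    using assms(2,3) by (simp_all add: e_def d_def)
  ultimately have sumd: "summable d"
    using summable_of_perturbed_descent by blast
  have "summable (\<lambda>k. (norm (Y (Suc k) - Y k))\<^sup>2)"
    \<comment> \<open>The factor normalizes the Y term of \<open>d\<close> to coefficient 1.\<close>
    by (rule summable_comparison_test'[OF summable_mult[OF sumd, of "2 / (1 + \<alpha>)"]])
      (use assms(2,3) in \<open>auto simp: d_def distrib_left\<close>)
  then have dY: "(\<lambda>k. Y (Suc k) - Y k) \<longlonglongrightarrow> 0"
    by (rule tendsto_zero_of_summable_norm_sq)
  have "summable (\<lambda>k. (norm (Z (Suc k) - Z k))\<^sup>2)"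
    by (rule summable_comparison_test'[OF summable_mult[OF sumd, of "2 / \<beta>"]])
      (use assms(2,3) in \<open>auto simp: d_def distrib_left\<close>)
  then have dZ: "(\<lambda>k. Z (Suc k) - Z k) \<longlonglongrightarrow> 0"
    by (rule tendsto_zero_of_summable_norm_sq)
  note dL = tendsto_zero_of_summable_norm_sq[OF sumL]
  note dP = tendsto_zero_of_summable_norm_sq[OF sumP]

  \<comment> \<open>The X update sees the old Y and Z, while the new multipliers contain the new
    ones; the residual is exactly this mismatch.\<close>
  have "A ** L (Suc k) + P (Suc k)
      = \<alpha> *\<^sub>R (A ** (Y (Suc k) - Y k)) + \<beta> *\<^sub>R (Z (Suc k) - Z k)" for k
    using optX[of k] unfolding assms(7,8)[of k]
    by (simp add: matrix_mult_linear_simps algebra_simps)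
  moreover have "(\<lambda>k. \<alpha> *\<^sub>R (A ** (Y (Suc k) - Y k)) + \<beta> *\<^sub>R (Z (Suc k) - Z k))
      \<longlonglongrightarrow> \<alpha> *\<^sub>R (A ** 0) + \<beta> *\<^sub>R 0"
    by (intro tendsto_intros T dY dZ)
  ultimately have "(\<lambda>k. A ** L (Suc k) + P (Suc k)) \<longlonglongrightarrow> 0"
    by (simp add: linear_0[OF matrix_mult_left_linear])
  \<comment> \<open>The identities hold only at successor indices; undoing the shift allows
    evaluation along the subsequence indices \<open>r n\<close>.\<close>
  then have limX: "(\<lambda>k. A ** L k + P k) \<longlonglongrightarrow> 0"
    by (rule LIMSEQ_imp_Suc)

  \<comment> \<open>Here only Z is outdated, so the second KKT residual is the Z step times
    \<open>A\<close>.\<close>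
  have "L (Suc k) = - (Y (Suc k) + Z k ** A + Q)" for k
    unfolding assms(7)[of k] optY[of k, symmetric] by simp
  then have "Y (Suc k) + Z (Suc k) ** A + Q + L (Suc k) = (Z (Suc k) - Z k) ** A" for k
    unfolding matrix_mult_linear_simps by simp
  moreover have "(\<lambda>k. (Z (Suc k) - Z k) ** A) \<longlonglongrightarrow> 0 ** A"
    by (intro T dZ)
  ultimately have "(\<lambda>k. Y (Suc k) + Z (Suc k) ** A + Q + L (Suc k)) \<longlonglongrightarrow> 0"
    by (simp add: linear_0[OF matrix_mult_right_linear])
  then have limY: "(\<lambda>k. Y k + Z k ** A + Q + L k) \<longlonglongrightarrow> 0"
    by (rule LIMSEQ_imp_Suc)

  \<comment> \<open>Z is updated last among the primal blocks, so the third KKT equation holds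
    exactly from index 1 on.\<close>
  have "P (Suc k) = - ((Y (Suc k) + Z (Suc k) ** A + Q) ** transpose A)" for k
    unfolding assms(8)[of k] optZ[of k, symmetric] by simp
  then have "Z (Suc k) ** A ** transpose A + (Y (Suc k) + Q) ** transpose A + P (Suc k) = 0" for k
    unfolding matrix_mult_linear_simps by simp
  then have limZ: "(\<lambda>k. Z k ** A ** transpose A + (Y k + Q) ** transpose A + P k) \<longlonglongrightarrow> 0"
    by - (rule LIMSEQ_imp_Suc, simp)

  \<comment> \<open>Feasibility residuals are rescaled multiplier steps, which vanish by the
    summability assumption.\<close>
  have "transpose A ** X (Suc k) - Y (Suc k) = (- 1 / \<alpha>) *\<^sub>R (L (Suc k) - L k)" for k
    using assms(2) assms(7)[of k] by simp
  moreover have "(\<lambda>k. (- 1 / \<alpha>) *\<^sub>R (L (Suc k) - L k)) \<longlonglongrightarrow> (- 1 / \<alpha>) *\<^sub>R 0"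
    by (intro tendsto_intros dL)
  ultimately have "(\<lambda>k. transpose A ** X (Suc k) - Y (Suc k)) \<longlonglongrightarrow> 0"
    by simp
  then have limL: "(\<lambda>k. transpose A ** X k - Y k) \<longlonglongrightarrow> 0"
    by (rule LIMSEQ_imp_Suc)

  have "X (Suc k) - Z (Suc k) = (- 1 / \<beta>) *\<^sub>R (P (Suc k) - P k)" for k
    using assms(3) assms(8)[of k] by simp
  moreover have "(\<lambda>k. (- 1 / \<beta>) *\<^sub>R (P (Suc k) - P k)) \<longlonglongrightarrow> (- 1 / \<beta>) *\<^sub>R 0"
    by (intro tendsto_intros dP)
  ultimately have "(\<lambda>k. X (Suc k) - Z (Suc k)) \<longlonglongrightarrow> 0"
    by simp
  then have limP: "(\<lambda>k. X k - Z k) \<longlonglongrightarrow> 0"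
    by (rule LIMSEQ_imp_Suc)

  obtain r where r: "strict_mono r"
    and lim: "(\<lambda>n. (X (r n), Y (r n), Z (r n), L (r n), P (r n))) \<longlonglongrightarrow> (Xs, Ys, Zs, Ls, Ps)"
    using assms(11) unfolding accumulation_point_def by (auto simp: o_def)
  have lims: "(\<lambda>n. X (r n)) \<longlonglongrightarrow> Xs" "(\<lambda>n. Y (r n)) \<longlonglongrightarrow> Ys" "(\<lambda>n. Z (r n)) \<longlonglongrightarrow> Zs"
    "(\<lambda>n. L (r n)) \<longlonglongrightarrow> Ls" "(\<lambda>n. P (r n)) \<longlonglongrightarrow> Ps"
    using tendsto_fst[OF lim] tendsto_fst[OF tendsto_snd[OF lim]]
      tendsto_fst[OF tendsto_snd[OF tendsto_snd[OF lim]]]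
      tendsto_fst[OF tendsto_snd[OF tendsto_snd[OF tendsto_snd[OF lim]]]]
      tendsto_snd[OF tendsto_snd[OF tendsto_snd[OF tendsto_snd[OF lim]]]]
    by simp_all
  \<comment> \<open>Each residual tends to 0 along \<open>r\<close> and, by continuity, also to its
    value at the accumulation point; limits are unique.\<close>
  have residual_zero: "l = 0" if "f \<longlonglongrightarrow> 0" and "(\<lambda>n. f (r n)) \<longlonglongrightarrow> l"
    for f :: "nat \<Rightarrow> real ^ 'n ^ 'n" and l
    using LIMSEQ_subseq_LIMSEQ[OF that(1) r] that(2) LIMSEQ_unique unfolding o_def by blast
  show ?thesis
    unfolding kkt_conditions_def
    by (intro conjI residual_zero[OF limX] residual_zero[OF limY] residual_zero[OF limZ]
        residual_zero[OF limL] residual_zero[OF limP] tendsto_intros T lims)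
qed

end
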